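(* Let $S\subset\mathbb{R}^n$ be a closed set such that $\operatorname{cl}(\operatorname{int}S)$ is epi-Lipschitz and has compact boundary. Then $S$ is $r$-prox-regular for some $r>0$ if and only if $S$ satisfies the extended exterior $r'$-sphere condition for some $r'>0$.
   Context: $\mathbb{R}^n$ carries the standard inner product $\langle\cdot,\cdot\rangle$ and the Euclidean norm $\|\cdot\|$. $B(y;\rho)$ denotes the open ball of radius $\rho>0$ centered at $y$; $\operatorname{int}$, $\operatorname{cl}$, $\operatorname{bdry}$ denote interior, closure, boundary. For a closed set $S\subset\mathbb{R}^n$ and $x\in S$, the proximal normal cone $N^P_S(x)$ is the set of all $\zeta\in\mathbb{R}^n$ for which there exists $\sigma\ge 0$ with $\langle \zeta,s-x\rangle\le\sigma\|s-x\|^2$ for all $s\in S$. A nonzero $\zeta\in N^P_S(x)$ is said to be realized by an $r$-sphere ($r>0$) if $B\left(x+r\frac{\zeta}{\|\zeta\|};r\right)\cap S=\emptyset$ (equivalently, $\left\langle \frac{\zeta}{\|\zeta\|},s-x\right\rangle\le\frac{1}{2r}\|s-x\|^2$ for all $s\in S$). A closed set $S$ is $r$-prox-regular ($r>0$) if for every $x\in\operatorname{bdry}S$, every $0\neq\zeta\in N^P_S(x)$ is realized by an $r$-sphere. A closed set $S$ satisfies the extended exterior $r$-sphere condition ($r>0$) if both of the following hold: (1) for every $x\in\operatorname{bdry}(\operatorname{int}S)$ (which is a subset of $\operatorname{bdry}S$) there exists $0\neq\zeta\in N^P_S(x)$ that is realized by an $r$-sphere; (2) for every $x\in(\operatorname{bdry}S)\setminus\operatorname{bdry}(\operatorname{int}S)$,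 every $0\neq\zeta\in N^P_S(x)$ is realized by an $r$-sphere. A closed set $A\subset\mathbb{R}^n$ is epi-Lipschitz at $x\in A$ if near $x$, after application of an orthogonal matrix, $A$ can be viewed as the epigraph of a Lipschitz continuous function; that is, there exist a neighborhood $U$ of $x$, an orthogonal $n\times n$ matrix $Q$ and a Lipschitz function $f:\mathbb{R}^{n-1}\to\mathbb{R}$ such that $A\cap U=\{y\in U : Qy\in\operatorname{epi}f\}$, where $\operatorname{epi}f=\{(z,t)\in\mathbb{R}^{n-1}\times\mathbb{R} : t\ge f(z)\}$. (Equivalently, the Clarke tangent cone of $A$ at $x$ has nonempty interior; equivalently, the Clarke normal cone $N_A(x)$ is pointed, i.e. $N_A(x)\cap -N_A(x)=\{0\}$.) The set $A$ is epi-Lipschitz if it is epi-Lipschitz at every $x\in A$. *)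

theory Defs
  imports "HOL-Analysis.Analysis"
begin

definition proximal_normal_cone :: "'a::euclidean_space set \<Rightarrow> 'a \<Rightarrow> 'a set" where
  "proximal_normal_cone S x =
     {\<zeta>. \<exists>\<sigma>\<ge>0. \<forall>s\<in>S. \<zeta> \<bullet> (s - x) \<le> \<sigma> * (norm (s - x))\<^sup>2}"

text \<open>The next notions are meant for closed \<open>S\<close> and \<open>r > 0\<close>, and the first one for \<open>\<zeta> \<noteq> 0\<close>;
  \<open>sgn \<zeta>\<close> is the unit vector in the direction of \<open>\<zeta>\<close>.\<close>

definition realized_by_sphere :: "real \<Rightarrow> 'a::euclidean_space set \<Rightarrow> 'a \<Rightarrow> 'a \<Rightarrow> bool" where
  "realized_by_sphere r S x \<zeta> \<longleftrightarrow> ball (x + r *\<^sub>R sgn \<zeta>) r \<inter> S = {}"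

definition prox_regular :: "real \<Rightarrow> 'a::euclidean_space set \<Rightarrow> bool" where
  "prox_regular r S \<longleftrightarrow>
     (\<forall>x\<in>frontier S. \<forall>\<zeta>\<in>proximal_normal_cone S x. \<zeta> \<noteq> 0 \<longrightarrow> realized_by_sphere r S x \<zeta>)"

definition extended_exterior_sphere_condition :: "real \<Rightarrow> 'a::euclidean_space set \<Rightarrow> bool" where
  "extended_exterior_sphere_condition r S \<longleftrightarrow>
     (\<forall>x\<in>frontier (interior S).
        \<exists>\<zeta>\<in>proximal_normal_cone S x. \<zeta> \<noteq> 0 \<and> realized_by_sphere r S x \<zeta>) \<and>
     (\<forall>x\<in>frontier S - frontier (interior S).
        \<forall>\<zeta>\<in>proximal_normal_cone S x. \<zeta> \<noteq> 0 \<longrightarrow> realized_by_sphere r S x \<zeta>)"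

text \<open>\<open>\<real>\<^sup>n\<close> is split as \<open>\<real>\<^sup>n\<^sup>-\<^sup>1 \<times> \<real>\<close> by singling out a coordinate \<open>k\<close>: the factor \<open>\<real>\<^sup>n\<^sup>-\<^sup>1\<close> is the
  coordinate hyperplane \<open>{z. z $ k = 0}\<close>, and \<open>w\<close> corresponds to the pair consisting of its
  projection to that hyperplane and of \<open>w $ k\<close>. A type of dimension \<open>n - 1\<close> would exclude \<open>n = 1\<close>.
  Coordinate permutations are orthogonal, so the choice of \<open>k\<close> is immaterial below.\<close>

definition coord_hyperplane :: "'n::finite \<Rightarrow> (real ^ 'n) set" where
  "coord_hyperplane k = {z. z $ k = 0}"

definition split_coord :: "'n::finite \<Rightarrow> real ^ 'n \<Rightarrow> (real ^ 'n) \<times> real" where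
  "split_coord k w = ((\<chi> i. if i = k then 0 else w $ i), w $ k)"

definition epi_lipschitz_at :: "(real ^ 'n::finite) set \<Rightarrow> real ^ 'n \<Rightarrow> bool" where
  "epi_lipschitz_at A x \<longleftrightarrow>
     (\<exists>(U :: (real ^ 'n) set) (Q :: real ^ 'n ^ 'n) (k :: 'n) (f :: real ^ 'n \<Rightarrow> real) L.
        open U \<and> x \<in> U \<and> orthogonal_matrix Q \<and> L-lipschitz_on (coord_hyperplane k) f \<and>
        A \<inter> U = {y \<in> U. split_coord k (Q *v y) \<in> epigraph (coord_hyperplane k) f})"

definition epi_lipschitz :: "(real ^ 'n::finite) set \<Rightarrow> bool" where
  "epi_lipschitz A \<longleftrightarrow> (\<forall>x\<in>A. epi_lipschitz_at A x)"

end

theory Submission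
  imports Defs
begin

text \<open>For the nontrivial implication, let \<open>x\<close> be a boundary point of \<open>interior S\<close>, near which
  \<open>closure (interior S)\<close> is the set \<open>g y \<le> e \<bullet> y\<close> with \<open>g\<close> Lipschitz and invariant in the unit
  direction \<open>e\<close>. An exterior normal \<open>\<nu>\<close> at a nearby boundary point \<open>y\<close> has \<open>\<nu> \<bullet> e\<close> negative and
  bounded away from \<open>0\<close>. Given \<open>a \<in> S\<close>, put \<open>m = x + t (a - x)\<close> for small \<open>t > 0\<close> and let \<open>y\<close> be the
  boundary point above or below \<open>m\<close>. The exterior sphere at \<open>y\<close> avoids both \<open>a\<close> and \<open>x\<close>, and this
  forces \<open>m + t \<kappa> \<parallel>a - x\<parallel>\<^sup>2 e \<in> S\<close>, where \<open>\<kappa>\<close> depends only on the radius and the Lipschitz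
  constant. Testing a proximal normal \<open>\<zeta>\<close> at \<open>x\<close> against these points and letting \<open>t\<close> tend to \<open>0\<close>
  yields \<open>\<zeta> \<bullet> (a - x) \<le> \<kappa> \<parallel>\<zeta>\<parallel> \<parallel>a - x\<parallel>\<^sup>2\<close>. Compactness makes \<open>\<kappa>\<close> uniform.\<close>

section \<open>Exterior spheres as quadratic inequalities\<close>

lemma ball_disjoint_iff_inner_le:
  fixes x \<nu> :: "'a::euclidean_space"
  assumes "norm \<nu> = 1" "r > 0"
  shows "ball (x + r *\<^sub>R \<nu>) r \<inter> S = {} \<longleftrightarrow> (\<forall>s\<in>S. 2 * r * (\<nu> \<bullet> (s - x)) \<le> (norm (s - x))\<^sup>2)"
proof -
  have "s \<notin> ball (x + r *\<^sub>R \<nu>) r \<longleftrightarrow> 2 * r * (\<nu> \<bullet> (s - x)) \<le> (norm (s - x))\<^sup>2" for s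
  proof -
    have "\<nu> \<bullet> \<nu> = 1"
      using assms(1) by (simp add: dot_square_norm)
    have "(dist (x + r *\<^sub>R \<nu>) s)\<^sup>2 = (norm ((s - x) - r *\<^sub>R \<nu>))\<^sup>2"
      by (simp add: dist_norm norm_minus_commute algebra_simps)
    also have "\<dots> = (norm (s - x))\<^sup>2 - 2 * r * (\<nu> \<bullet> (s - x)) + r\<^sup>2"
      using \<open>\<nu> \<bullet> \<nu> = 1\<close> unfolding power2_norm_eq_inner
      by (simp add: inner_diff_left inner_diff_right inner_commute power2_eq_square algebra_simps)
    finally have *: "(dist (x + r *\<^sub>R \<nu>) s)\<^sup>2 = (norm (s - x))\<^sup>2 - 2 * r * (\<nu> \<bullet> (s - x)) + r\<^sup>2" .
    have "r \<le> dist (x + r *\<^sub>R \<nu>) s \<longleftrightarrow> r\<^sup>2 \<le> (dist (x + r *\<^sub>R \<nu>) s)\<^sup>2"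
      using assms(2) by (simp add: power_mono_iff)
    then show ?thesis
      unfolding * by (auto simp: not_less)
  qed
  then show ?thesis
    by blast
qed

lemma realized_by_sphere_iff:
  assumes "\<zeta> \<noteq> 0" "r > 0"
  shows "realized_by_sphere r S x \<zeta> \<longleftrightarrow> (\<forall>s\<in>S. 2 * r * (sgn \<zeta> \<bullet> (s - x)) \<le> (norm (s - x))\<^sup>2)"
  unfolding realized_by_sphere_def
  using assms by (intro ball_disjoint_iff_inner_le) (auto simp: norm_sgn)

text \<open>Both balls are tangent at \<open>x\<close> on the same side, so the smaller one lies
  inside the larger. In inequality form, only points with nonnegative inner product need the
  inequality for \<open>r\<close>.\<close>

lemma realized_by_sphere_mono:
  assumes "realized_by_sphere r S x \<zeta>" "\<zeta> \<noteq> 0" "0 < r'" "r' \<le> r"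
  shows "realized_by_sphere r' S x \<zeta>"
proof -
  have "r > 0"
    using assms by simp
  have "2 * r' * (sgn \<zeta> \<bullet> (s - x)) \<le> (norm (s - x))\<^sup>2" if "s \<in> S" for s
  proof (cases "sgn \<zeta> \<bullet> (s - x) \<ge> 0")
    case True
    then have "2 * r' * (sgn \<zeta> \<bullet> (s - x)) \<le> 2 * r * (sgn \<zeta> \<bullet> (s - x))"
      using assms(4) by (intro mult_right_mono) auto
    also have "\<dots> \<le> (norm (s - x))\<^sup>2"
      using assms(1) that realized_by_sphere_iff[OF \<open>\<zeta> \<noteq> 0\<close> \<open>r > 0\<close>] by blast
    finally show ?thesis .
  next
    case False
    then have "2 * r' * (sgn \<zeta> \<bullet> (s - x)) \<le> 0"
      using assms(3) by (intro mult_nonneg_nonpos) auto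
    then show ?thesis
      using zero_le_power2 order_trans by blast
  qed
  then show ?thesis
    using realized_by_sphere_iff[OF assms(2,3)] by blast
qed

section \<open>Closest points and limits of realized normals\<close>

lemma proximal_normal_cone_closest_point:
  assumes "closed S" "S \<noteq> {}"
  shows "y - closest_point S y \<in> proximal_normal_cone S (closest_point S y)"
proof -
  define p where "p = closest_point S y"
  have "(y - p) \<bullet> (s - p) \<le> 1 / 2 * (norm (s - p))\<^sup>2" if "s \<in> S" for s
  proof -
    have "dist y p \<le> dist y s"
      unfolding p_def using closest_point_le[OF assms(1) that] .
    then have "(norm (y - p))\<^sup>2 \<le> (norm ((y - p) - (s - p)))\<^sup>2"
      by (simp add: dist_norm)
    also have "\<dots> = (norm (y - p))\<^sup>2 - 2 * ((y - p) \<bullet> (s - p)) + (norm (s - p))\<^sup>2"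
      unfolding power2_norm_eq_inner
      by (simp add: inner_diff_left inner_diff_right inner_commute)
    finally show ?thesis
      by simp
  qed
  then show ?thesis
    unfolding proximal_normal_cone_def p_def[symmetric] by (auto intro!: exI[of _ "1/2"])
qed

lemma closest_point_in_frontier:
  fixes S :: "'a::euclidean_space set"
  assumes "closed S" "S \<noteq> {}" "y \<notin> S"
  shows "closest_point S y \<in> frontier S"
proof -
  have "closest_point S y \<notin> interior S"
  proof
    assume int: "closest_point S y \<in> interior S"
    \<comment> \<open>A nonempty interior makes the affine hull the whole space, so relative
      interior and relative frontier become the ordinary ones and the fact about closest points in
      the relative frontier applies.\<close>
    then have "interior S \<noteq> {}"
      by blast
    then have "affine hull S = UNIV" "rel_interior S = interior S"
      by (auto simp: affine_hull_nonempty_interior rel_interior_nonempty_interior)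
    then have "closest_point S y \<in> rel_frontier S"
      using assms interior_subset by (intro closest_point_in_rel_frontier) auto
    then show False
      using int \<open>rel_interior S = interior S\<close> by (simp add: rel_frontier_def)
  qed
  then show ?thesis
    using assms closest_point_in_set by (simp add: frontier_def)
qed

text \<open>Prox-regularity at \<open>x\<close> alone could hold vacuously, so a nonzero normal has
  to be produced. Points \<open>y n\<close> outside \<open>S\<close> tending to \<open>x\<close>
  have closest points \<open>p n\<close> that carry the normals \<open>y n - p n\<close>, all
  realized with the same \<open>r\<close>. A limit of the unit normals along a subsequence inherits
  the sphere inequality because the radius stays fixed.\<close>

lemma prox_regular_imp_sphere_normal:
  fixes S :: "'a::euclidean_space set"
  assumes "closed S" "prox_regular r S" "r > 0" "x \<in> frontier S"
  shows "\<exists>\<zeta>\<in>proximal_normal_cone S x. \<zeta> \<noteq> 0 \<and> realized_by_sphere r S x \<zeta>"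
proof -
  have "x \<in> S"
    using assms by (simp add: frontier_def)
  then have "S \<noteq> {}"
    by blast
  have "x \<in> closure (- S)"
    using assms(4) by (simp add: frontier_closures)
  then obtain y where y: "\<And>n. y n \<in> - S" "y \<longlonglongrightarrow> x"
    by (auto simp: closure_sequential)
  define p where "p n = closest_point S (y n)" for n
  define u where "u n = sgn (y n - p n)" for n
  have pS: "p n \<in> S" for n
    unfolding p_def by (rule closest_point_in_set[OF assms(1) \<open>S \<noteq> {}\<close>])
  have ne: "y n - p n \<noteq> 0" for n
    using pS[of n] y(1)[of n] by auto
  have "p n \<in> frontier S" for n
    unfolding p_def using closest_point_in_frontier[OF assms(1) \<open>S \<noteq> {}\<close>] y(1)[of n] by simp
  then have real: "realized_by_sphere r S (p n) (y n - p n)" for n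
    using assms(2) ne[of n] proximal_normal_cone_closest_point[OF assms(1) \<open>S \<noteq> {}\<close>, of "y n"]
    unfolding prox_regular_def p_def by blast
  have "(\<lambda>n. y n - p n) \<longlonglongrightarrow> 0"
  proof (rule Lim_null_comparison)
    \<comment> \<open>\<open>x\<close> itself lies in \<open>S\<close> and so competes with the
      closest point.\<close>
    have "norm (y n - p n) \<le> norm (y n - x)" for n
      using closest_point_le[OF assms(1) \<open>x \<in> S\<close>, of "y n"] by (simp add: p_def dist_norm)
    then show "\<forall>\<^sub>F n in sequentially. norm (y n - p n) \<le> norm (y n - x)"
      by simp
    show "(\<lambda>n. norm (y n - x)) \<longlonglongrightarrow> 0"
      using y(2) by (simp add: LIM_zero tendsto_norm_zero)
  qed
  from tendsto_diff[OF y(2) this] have plim: "p \<longlonglongrightarrow> x"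
    by simp
  have "u n \<in> sphere 0 1" for n
    using ne[of n] by (simp add: u_def norm_sgn)
  then obtain v \<phi> where v: "v \<in> sphere 0 1" "strict_mono \<phi>" "(u \<circ> \<phi>) \<longlonglongrightarrow> v"
    using compact_sphere[of "0::'a" 1] unfolding compact_def by metis
  have "norm v = 1"
    using v(1) by simp
  then have "v \<noteq> 0" "sgn v = v"
    by (auto simp: sgn_div_norm)
  have plim': "(p \<circ> \<phi>) \<longlonglongrightarrow> x"
    using LIMSEQ_subseq_LIMSEQ[OF plim v(2)] .
  have ineq: "2 * r * (v \<bullet> (s - x)) \<le> (norm (s - x))\<^sup>2" if "s \<in> S" for s
  proof (rule LIMSEQ_le)
    show "(\<lambda>n. 2 * r * ((u \<circ> \<phi>) n \<bullet> (s - (p \<circ> \<phi>) n))) \<longlonglongrightarrow> 2 * r * (v \<bullet> (s - x))"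
      by (intro tendsto_intros v plim')
    show "(\<lambda>n. (norm (s - (p \<circ> \<phi>) n))\<^sup>2) \<longlonglongrightarrow> (norm (s - x))\<^sup>2"
      by (intro tendsto_intros plim')
    have "2 * r * (u n \<bullet> (s - p n)) \<le> (norm (s - p n))\<^sup>2" for n
      using real[of n] that unfolding realized_by_sphere_iff[OF ne \<open>r > 0\<close>] u_def by blast
    then show "\<exists>N. \<forall>n\<ge>N. 2 * r * ((u \<circ> \<phi>) n \<bullet> (s - (p \<circ> \<phi>) n)) \<le> (norm (s - (p \<circ> \<phi>) n))\<^sup>2"
      by simp
  qed
  have "realized_by_sphere r S x v"
    unfolding realized_by_sphere_iff[OF \<open>v \<noteq> 0\<close> \<open>r > 0\<close>] \<open>sgn v = v\<close> using ineq by blast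
  moreover have "v \<in> proximal_normal_cone S x"
    unfolding proximal_normal_cone_def using ineq \<open>r > 0\<close>
    by (auto intro!: exI[of _ "1 / (2 * r)"] simp: field_simps)
  ultimately show ?thesis
    using \<open>v \<noteq> 0\<close> by blast
qed

section \<open>Normals to sets that locally contain a Lipschitz epigraph\<close>

text \<open>A proximal normal has nonpositive inner product with every direction that leads into the
  epigraph, and these directions form a cone around \<open>e\<close> whose width is governed by
  \<open>L\<close>. Hence the normal cannot be nearly orthogonal to \<open>e\<close>.\<close>

lemma exterior_normal_inner_le:
  fixes S U :: "'a::euclidean_space set"
  assumes "open U" "y \<in> U" "norm e = 1" "norm \<nu> = 1"
    and lip: "L-lipschitz_on UNIV g"
    and inv: "\<And>z t. g (z + t *\<^sub>R e) = g z"
    and sub: "\<And>z. z \<in> U \<Longrightarrow> g z \<le> e \<bullet> z \<Longrightarrow> z \<in> S"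
    and "g y = e \<bullet> y"
    and normal: "\<And>s. s \<in> S \<Longrightarrow> \<nu> \<bullet> (s - y) \<le> C * (norm (s - y))\<^sup>2"
  shows "1 \<le> (L + 2) * - (\<nu> \<bullet> e)"
proof -
  define \<alpha> where "\<alpha> = \<nu> \<bullet> e"
  define v where "v = \<nu> - \<alpha> *\<^sub>R e"
  have "L \<ge> 0"
    using lip by (rule lipschitz_on_nonneg)
  have ee: "e \<bullet> e = 1" and nn: "\<nu> \<bullet> \<nu> = 1"
    using assms by (auto simp: dot_square_norm)
  have ev: "e \<bullet> v = 0"
    by (simp add: v_def \<alpha>_def inner_diff_right ee inner_commute)
  have nv: "\<nu> \<bullet> v = 1 - \<alpha>\<^sup>2"
    by (simp add: v_def inner_diff_right nn \<alpha>_def[symmetric] power2_eq_square)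
  have "v \<bullet> v = 1 - \<alpha>\<^sup>2"
    using ev nv by (simp add: v_def inner_diff_left)
  then have "(norm v)\<^sup>2 = 1 - \<alpha>\<^sup>2"
    by (simp add: power2_norm_eq_inner)
  then have "(norm v)\<^sup>2 \<le> 1\<^sup>2"
    by simp
  then have "norm v \<le> 1"
    by (rule power2_le_imp_le) simp
  have "\<bar>\<alpha>\<bar> \<le> 1"
    unfolding \<alpha>_def using Cauchy_Schwarz_ineq2[of \<nu> e] assms by simp
  then have "\<alpha>\<^sup>2 \<le> 1"
    by (simp add: abs_square_le_1)
  \<comment> \<open>Along \<open>v\<close>, the part of \<nu> orthogonal to \<open>e\<close>,
    \<open>g\<close> grows at rate at most \<open>L * norm v\<close>; rising faster than that along
    \<open>e\<close> keeps \<open>y + t w\<close> in the epigraph. The extra 1 keeps the coefficient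
    positive even if \<open>L\<close> or \<open>v\<close> vanishes, which later gives \<alpha> \<le>
    0.\<close>
  define w where "w = (L * norm v + 1) *\<^sub>R e + v"
  have "\<nu> \<bullet> w \<le> 0"
  \<comment> \<open>The normal inequality is tested at \<open>y + t w\<close> and divided by
    \<open>t\<close>, which leaves a right-hand side of order \<open>t\<close>.\<close>
  proof (rule tendsto_le[of "at_right (0::real)"])
    show "((\<lambda>t. C * (t * (norm w)\<^sup>2)) \<longlongrightarrow> 0) (at_right 0)"
      by (rule tendsto_eq_intros refl | simp)+
    show "((\<lambda>t. \<nu> \<bullet> w) \<longlongrightarrow> \<nu> \<bullet> w) (at_right (0::real))"
      by simp
    have "((\<lambda>t. y + t *\<^sub>R w) \<longlongrightarrow> y) (at_right (0::real))"
      by (rule tendsto_eq_intros refl | simp)+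
    from topological_tendstoD[OF this assms(1,2)]
    have "\<forall>\<^sub>F t in at_right 0. y + t *\<^sub>R w \<in> U" .
    moreover have "\<forall>\<^sub>F t::real in at_right 0. t > 0"
      by (simp add: eventually_at_right_less)
    ultimately show "\<forall>\<^sub>F t in at_right 0. \<nu> \<bullet> w \<le> C * (t * (norm w)\<^sup>2)"
    proof eventually_elim
      case (elim t)
      have "g (y + t *\<^sub>R w) = g ((y + t *\<^sub>R v) + (t * (L * norm v + 1)) *\<^sub>R e)"
        by (simp add: w_def algebra_simps)
      also have "\<dots> = g (y + t *\<^sub>R v)"
        by (rule inv)
      also have "\<dots> \<le> g y + L * norm (t *\<^sub>R v)"
        using lipschitz_onD[OF lip, of "y + t *\<^sub>R v" y] by (simp add: dist_norm)
      also have "\<dots> \<le> e \<bullet> (y + t *\<^sub>R w)"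
        using elim \<open>g y = e \<bullet> y\<close> by (simp add: w_def inner_add_right ev ee algebra_simps)
      finally have "y + t *\<^sub>R w \<in> S"
        using sub elim by blast
      from normal[OF this] have "t * (\<nu> \<bullet> w) \<le> t * (C * (t * (norm w)\<^sup>2))"
        by (simp add: power_mult_distrib power2_eq_square mult_ac)
      then show ?case
        using elim by simp
    qed
  qed simp
  then have *: "(L * norm v + 1) * \<alpha> + 1 - \<alpha>\<^sup>2 \<le> 0"
    by (simp add: w_def inner_add_right nv \<alpha>_def[symmetric])
  have "(L * norm v + 1) * \<alpha> \<le> 0"
    using * \<open>\<alpha>\<^sup>2 \<le> 1\<close> by linarith
  moreover have "0 < L * norm v + 1"
    using \<open>L \<ge> 0\<close> by (simp add: add_nonneg_pos)
  ultimately have "\<alpha> \<le> 0"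
    by (simp add: mult_le_0_iff)
  \<comment> \<open>This absorbs the square: the bound becomes 1 \<le> (\<open>L\<close> +
    1)(-\<alpha>) + (-\<alpha>), whence the constant \<open>L + 2\<close>.\<close>
  have "\<alpha>\<^sup>2 \<le> - \<alpha>"
    using \<open>\<alpha> \<le> 0\<close> \<open>\<bar>\<alpha>\<bar> \<le> 1\<close> mult_left_mono[of "- \<alpha>" 1 "- \<alpha>"] by (simp add: power2_eq_square)
  moreover have "(L * norm v + 1) * - \<alpha> \<le> (L * 1 + 1) * - \<alpha>"
    using \<open>\<alpha> \<le> 0\<close> \<open>L \<ge> 0\<close> \<open>norm v \<le> 1\<close> by (intro mult_right_mono add_right_mono mult_left_mono) auto
  ultimately show ?thesis
    using * by (simp add: \<alpha>_def[symmetric] algebra_simps)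
qed

text \<open>One sphere at each nearby graph point controls every proximal normal at
  \<open>x\<close>. The quadratic constant that comes with \<zeta> disappears in the limit, so the
  resulting bound depends only on \<open>L\<close>, \<open>r\<close> and the norm of
  \<zeta>.\<close>

lemma proximal_normal_inner_le:
  fixes S U :: "'a::euclidean_space set"
  assumes "open U" "x \<in> U" "norm e = 1" "r > 0"
    and lip: "L-lipschitz_on UNIV g"
    and inv: "\<And>z t. g (z + t *\<^sub>R e) = g z"
    and sub: "\<And>z. z \<in> U \<Longrightarrow> g z \<le> e \<bullet> z \<Longrightarrow> z \<in> S"
    and sph: "\<And>z. z \<in> U \<Longrightarrow> g z = e \<bullet> z \<Longrightarrow>
          \<exists>\<nu>. norm \<nu> = 1 \<and> (\<forall>s\<in>S. 2 * r * (\<nu> \<bullet> (s - z)) \<le> (norm (s - z))\<^sup>2)"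
    and gx: "g x = e \<bullet> x"
    and \<zeta>: "\<zeta> \<in> proximal_normal_cone S x"
    and "a \<in> S"
  shows "\<zeta> \<bullet> (a - x) \<le> (L + 2) ^ 3 / r * norm \<zeta> * (norm (a - x))\<^sup>2"
proof -
  \<comment> \<open>Two of the three factors \<open>L + 2\<close> come from squared distances to
    \<open>y t\<close>, the third from the slope of the normal there.\<close>
  define \<kappa> where "\<kappa> = (L + 2) ^ 3 / r"
  \<comment> \<open>The direction towards \<open>a\<close>, tilted along \<open>e\<close> just
    enough that \<open>x + t d\<close> lies on or above the graph for small
    \<open>t > 0\<close>.\<close>
  define d where "d = (a - x) + (\<kappa> * (norm (a - x))\<^sup>2) *\<^sub>R e"
  define m where "m t = x + t *\<^sub>R (a - x)" for t
  define y where "y t = m t + (g (m t) - e \<bullet> m t) *\<^sub>R e" for t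
  have "L \<ge> 0"
    using lip by (rule lipschitz_on_nonneg)
  then have "\<kappa> \<ge> 0"
    using \<open>r > 0\<close> by (simp add: \<kappa>_def)
  have ee: "e \<bullet> e = 1"
    using assms by (simp add: dot_square_norm)
  have "x \<in> S"
    using sub[OF \<open>x \<in> U\<close>] gx by simp
  obtain C where C: "\<And>s. s \<in> S \<Longrightarrow> \<zeta> \<bullet> (s - x) \<le> C * (norm (s - x))\<^sup>2"
    using \<zeta> unfolding proximal_normal_cone_def by blast
  \<comment> \<open>This bounds how far \<open>m t\<close> can lie below the graph;
    \<open>y t\<close> is its projection to the graph along \<open>e\<close>.\<close>
  have height: "g (m t) - e \<bullet> m t \<le> t * \<kappa> * (norm (a - x))\<^sup>2"
    if t: "0 < t" "t < 1" "y t \<in> U" for t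
  proof -
    define h where "h = g (m t) - e \<bullet> m t"
    have gy: "g (y t) = e \<bullet> y t"
      by (simp add: y_def inv inner_add_right ee)
    obtain \<nu> where \<nu>: "norm \<nu> = 1" "\<And>s. s \<in> S \<Longrightarrow> 2 * r * (\<nu> \<bullet> (s - y t)) \<le> (norm (s - y t))\<^sup>2"
      using sph[OF t(3) gy] by blast
    have "\<nu> \<bullet> (s - y t) \<le> 1 / (2 * r) * (norm (s - y t))\<^sup>2" if "s \<in> S" for s
      using \<nu>(2)[OF that] \<open>r > 0\<close> by (simp add: field_simps)
    from exterior_normal_inner_le[OF \<open>open U\<close> t(3) \<open>norm e = 1\<close> \<nu>(1) lip inv sub gy this]
    have \<nu>e: "1 \<le> (L + 2) * - (\<nu> \<bullet> e)" .
    have ym: "y t - m t = h *\<^sub>R e"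
      by (simp add: y_def h_def)
    then have norm_ym: "norm (y t - m t) = \<bar>h\<bar>"
      by (simp add: \<open>norm e = 1\<close>)
    have mx: "norm (m t - x) = t * norm (a - x)"
      using t by (simp add: m_def)
    have "\<bar>h\<bar> \<le> \<bar>g (m t) - g x\<bar> + \<bar>e \<bullet> (m t - x)\<bar>"
      by (simp add: h_def gx inner_diff_right)
    also have "\<dots> \<le> L * norm (m t - x) + norm (m t - x)"
      using lipschitz_onD[OF lip, of "m t" x] Cauchy_Schwarz_ineq2[of e "m t - x"] \<open>norm e = 1\<close>
      by (intro add_mono) (auto simp: dist_norm)
    finally have h: "\<bar>h\<bar> \<le> (L + 1) * t * norm (a - x)"
      by (simp add: mx algebra_simps)
    have "norm (x - y t) \<le> norm (m t - x) + norm (y t - m t)"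
      using norm_triangle_ineq[of "m t - x" "y t - m t"] by (simp add: norm_minus_commute)
    also have "\<dots> \<le> (L + 2) * t * norm (a - x)"
      using h by (simp add: mx norm_ym algebra_simps)
    finally have xy: "norm (x - y t) \<le> (L + 2) * t * norm (a - x)" .
    have "a - m t = (1 - t) *\<^sub>R (a - x)"
      by (simp add: m_def algebra_simps)
    then have "norm (a - m t) = (1 - t) * norm (a - x)"
      using t by simp
    then have "norm (a - y t) \<le> (1 - t) * norm (a - x) + (L + 1) * t * norm (a - x)"
      using norm_triangle_ineq4[of "a - m t" "y t - m t"] h norm_ym by simp
    also have "\<dots> = (1 + L * t) * norm (a - x)"
      by (simp add: algebra_simps)
    also have "\<dots> \<le> (L + 2) * norm (a - x)"
      using t \<open>L \<ge> 0\<close> mult_left_mono[of t 1 L] by (intro mult_right_mono) auto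
    finally have ay: "norm (a - y t) \<le> (L + 2) * norm (a - x)" .
    define D where "D = (L + 2)\<^sup>2 * (norm (a - x))\<^sup>2"
    have "D \<ge> 0"
      by (simp add: D_def)
    have a2: "(norm (a - y t))\<^sup>2 \<le> D"
      using power_mono[OF ay, of 2] by (simp add: D_def power_mult_distrib)
    \<comment> \<open>\<open>x\<close> enters the convex combination below with weight 1 -
      \<open>t\<close>, so its squared distance must itself be small. It is of order
      \<open>t\<close> squared; for \<open>a\<close>, a bounded squared distance suffices, since its
      weight is \<open>t\<close>.\<close>
    have "(norm (x - y t))\<^sup>2 \<le> t\<^sup>2 * D"
      using power_mono[OF xy, of 2] by (simp add: D_def power_mult_distrib mult_ac)
    also have "\<dots> \<le> t * D"
      using t \<open>D \<ge> 0\<close> by (intro mult_right_mono) (auto simp: power2_eq_square mult_le_cancel_left1)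
    finally have x2: "(norm (x - y t))\<^sup>2 \<le> t * D" .
    \<comment> \<open>Combining the sphere inequalities for \<open>a\<close> and \<open>x\<close>
      with these weights bounds the normal component of \<open>m t - y t\<close>, which is
      \<open>-h\<close> times \<open>e\<close>.\<close>
    have "m t - y t = t *\<^sub>R (a - y t) + (1 - t) *\<^sub>R (x - y t)"
      by (simp add: m_def algebra_simps)
    then have "\<nu> \<bullet> (m t - y t) = t * (\<nu> \<bullet> (a - y t)) + (1 - t) * (\<nu> \<bullet> (x - y t))"
      by (simp only: inner_add_right inner_scaleR_right)
    then have "2 * r * (\<nu> \<bullet> (m t - y t)) =
        t * (2 * r * (\<nu> \<bullet> (a - y t))) + (1 - t) * (2 * r * (\<nu> \<bullet> (x - y t)))"
      by (simp only: distrib_left mult_ac)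
    also have "\<dots> \<le> t * D + (1 - t) * (t * D)"
      using t \<nu>(2)[OF \<open>a \<in> S\<close>] \<nu>(2)[OF \<open>x \<in> S\<close>] a2 x2 by (intro add_mono mult_left_mono) auto
    also have "\<dots> \<le> t * D + 1 * (t * D)"
      using t \<open>D \<ge> 0\<close> by (intro add_left_mono mult_right_mono) auto
    finally have "r * (\<nu> \<bullet> (m t - y t)) \<le> t * D"
      by (simp add: mult_ac)
    moreover have "m t - y t = - (h *\<^sub>R e)"
      by (simp flip: ym)
    ultimately have rh: "r * (h * - (\<nu> \<bullet> e)) \<le> t * D"
      by simp
    \<comment> \<open>If \<open>h\<close> is positive, the lower bound on -(\<nu> \<bullet>
      \<open>e\<close>) turns the estimate of the normal component into one of
      \<open>h\<close>.\<close>
    have "h \<le> t * \<kappa> * (norm (a - x))\<^sup>2"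
    proof (cases "h \<le> 0")
      case True
      then show ?thesis
        using t \<open>\<kappa> \<ge> 0\<close> by (meson mult_nonneg_nonneg order_trans zero_le_power2 less_imp_le)
    next
      case False
      then have "r * h * 1 \<le> r * h * ((L + 2) * - (\<nu> \<bullet> e))"
        using \<nu>e \<open>r > 0\<close> by (intro mult_left_mono) auto
      also have "\<dots> = (L + 2) * (r * (h * - (\<nu> \<bullet> e)))"
        by simp
      also have "\<dots> \<le> (L + 2) * (t * D)"
        using rh \<open>L \<ge> 0\<close> by (intro mult_left_mono) auto
      finally show ?thesis
        using \<open>r > 0\<close> by (simp add: \<kappa>_def D_def field_simps power3_eq_cube power2_eq_square)
    qed
    then show ?thesis
      by (simp add: h_def)
  qed
  have "\<zeta> \<bullet> d \<le> 0"
  proof (rule tendsto_le[of "at_right (0::real)"])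
    show "((\<lambda>t. C * (t * (norm d)\<^sup>2)) \<longlongrightarrow> 0) (at_right 0)"
      by (rule tendsto_eq_intros refl | simp)+
    show "((\<lambda>t. \<zeta> \<bullet> d) \<longlongrightarrow> \<zeta> \<bullet> d) (at_right (0::real))"
      by simp
    have "continuous_on UNIV g"
      using lip by (rule lipschitz_on_continuous_on)
    then have "isCont g x"
      by (simp add: continuous_on_eq_continuous_at)
    have mlim: "(m \<longlongrightarrow> x) (at_right 0)"
      unfolding m_def by (rule tendsto_eq_intros refl | simp)+
    have "(y \<longlongrightarrow> x + (g x - e \<bullet> x) *\<^sub>R e) (at_right 0)"
      unfolding y_def by (intro tendsto_intros mlim isCont_tendsto_compose[OF \<open>isCont g x\<close>])
    then have "(y \<longlongrightarrow> x) (at_right 0)"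
      by (simp add: gx)
    from topological_tendstoD[OF this assms(1,2)]
    have "\<forall>\<^sub>F t in at_right 0. y t \<in> U" .
    moreover have "((\<lambda>t. x + t *\<^sub>R d) \<longlongrightarrow> x) (at_right (0::real))"
      by (rule tendsto_eq_intros refl | simp)+
    from topological_tendstoD[OF this assms(1,2)]
    have "\<forall>\<^sub>F t in at_right 0. x + t *\<^sub>R d \<in> U" .
    moreover have "\<forall>\<^sub>F t::real in at_right 0. t \<in> {0<..<1}"
      by (rule eventually_at_right_real) simp
    ultimately show "\<forall>\<^sub>F t in at_right 0. \<zeta> \<bullet> d \<le> C * (t * (norm d)\<^sup>2)"
    proof eventually_elim
      case (elim t)
      have b: "x + t *\<^sub>R d = m t + (t * \<kappa> * (norm (a - x))\<^sup>2) *\<^sub>R e"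
        by (simp add: d_def m_def algebra_simps)
      have "g (x + t *\<^sub>R d) \<le> e \<bullet> (x + t *\<^sub>R d)"
        unfolding b inv using height[of t] elim by (simp add: inner_add_right ee algebra_simps)
      then have "x + t *\<^sub>R d \<in> S"
        using sub elim by blast
      from C[OF this] have "t * (\<zeta> \<bullet> d) \<le> t * (C * (t * (norm d)\<^sup>2))"
        by (simp add: power_mult_distrib power2_eq_square mult_ac)
      then show ?case
        using elim by simp
    qed
  qed simp
  then have "\<zeta> \<bullet> (a - x) \<le> (\<kappa> * (norm (a - x))\<^sup>2) * - (\<zeta> \<bullet> e)"
    by (simp add: d_def inner_add_right)
  also have "\<dots> \<le> (\<kappa> * (norm (a - x))\<^sup>2) * norm \<zeta>"
    using \<open>\<kappa> \<ge> 0\<close> Cauchy_Schwarz_ineq2[of \<zeta> e] \<open>norm e = 1\<close> by (intro mult_left_mono) auto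
  finally show ?thesis
    by (simp add: \<kappa>_def mult_ac)
qed

section \<open>Epi-Lipschitz sets in coordinate-free form\<close>

text \<open>The rotation and the coordinate splitting are absorbed into \<open>e\<close>, the
  preimage of the \<open>k\<close>-th axis vector under \<open>Q\<close>, and into \<open>g\<close>,
  which extends \<open>f\<close> constantly along \<open>e\<close>. The constant \<open>L\<close>
  survives because \<open>Q\<close> is an isometry and the projection \<open>P\<close> is
  nonexpansive.\<close>

lemma epi_lipschitz_at_directional:
  fixes A :: "(real ^ 'n::finite) set"
  assumes "epi_lipschitz_at A x"
  obtains U e L g where "open U" "x \<in> U" "norm e = 1" "L-lipschitz_on UNIV g"
    "\<And>z t. g (z + t *\<^sub>R e) = g z" "A \<inter> U = {z \<in> U. g z \<le> e \<bullet> z}"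
proof -
  obtain U Q and k :: 'n and f L where *: "open U" "x \<in> U" "orthogonal_matrix Q"
    "L-lipschitz_on (coord_hyperplane k) f"
    "A \<inter> U = {y \<in> U. split_coord k (Q *v y) \<in> epigraph (coord_hyperplane k) f}"
    using assms unfolding epi_lipschitz_at_def by blast
  define P :: "real ^ 'n \<Rightarrow> real ^ 'n" where "P w = (\<chi> i. if i = k then 0 else w $ i)" for w
  define e where "e = transpose Q *v axis k 1"
  define g where "g z = f (P (Q *v z))" for z
  have ort: "orthogonal_transformation ((*v) Q)" "orthogonal_transformation ((*v) (transpose Q))"
    using *(3) by (auto simp: orthogonal_matrix_transpose orthogonal_transformation_matrix)
  have Qe: "Q *v e = axis k 1"
    using *(3) by (simp add: e_def matrix_vector_mul_assoc orthogonal_matrix_def del: transpose_matrix_vector)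
  have "norm e = 1"
    using orthogonal_transformation_norm[OF ort(2)]
    by (simp add: e_def del: transpose_matrix_vector)
  moreover have "L-lipschitz_on UNIV g"
  proof (rule lipschitz_onI)
    show "0 \<le> L"
      using *(4) by (rule lipschitz_on_nonneg)
    fix z z'
    have "dist (g z) (g z') \<le> L * dist (P (Q *v z)) (P (Q *v z'))"
      unfolding g_def using lipschitz_onD[OF *(4)] by (simp add: coord_hyperplane_def P_def)
    also have "dist (P (Q *v z)) (P (Q *v z')) \<le> dist (Q *v z) (Q *v z')"
      unfolding dist_norm by (rule norm_le_componentwise_cart) (simp add: P_def)
    also have "dist (Q *v z) (Q *v z') = dist z z'"
      using ort(1) by (simp add: orthogonal_transformation_isometry)
    finally show "dist (g z) (g z') \<le> L * dist z z'"
      using \<open>0 \<le> L\<close> by (simp add: mult_left_mono)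
  qed
  moreover have "g (z + t *\<^sub>R e) = g z" for z t
  proof -
    have "P (Q *v (z + t *\<^sub>R e)) = P (Q *v z)"
      by (simp add: vec_eq_iff P_def matrix_vector_right_distrib matrix_vector_mult_scaleR Qe axis_def)
    then show ?thesis
      by (simp add: g_def)
  qed
  moreover have "A \<inter> U = {z \<in> U. g z \<le> e \<bullet> z}"
  proof -
    have "(Q *v z) $ k = e \<bullet> z" for z
    proof -
      have "(Q *v z) $ k = (Q *v e) \<bullet> (Q *v z)"
        by (simp add: Qe inner_axis')
      also have "\<dots> = e \<bullet> z"
        using ort(1) by (simp add: orthogonal_transformation_def)
      finally show ?thesis .
    qed
    then show ?thesis
      unfolding *(5) by (auto simp: split_coord_def epigraph_def g_def P_def coord_hyperplane_def)
  qed
  ultimately show ?thesis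
    using that *(1,2) by blast
qed

text \<open>Strict inequality is an open condition and so gives interior points. At equality, an
  arbitrarily small move along \<open>-e\<close> lowers \<open>e \<bullet> z\<close> but not
  \<open>g z\<close>, and so leaves \<open>A\<close>.\<close>

lemma frontier_subgraph_iff:
  fixes A :: "'a::euclidean_space set"
  assumes "closed A" "open U" "z \<in> U" "norm e = 1" "L-lipschitz_on UNIV g"
    and inv: "\<And>z t. g (z + t *\<^sub>R e) = g z"
    and A: "A \<inter> U = {z \<in> U. g z \<le> e \<bullet> z}"
  shows "z \<in> frontier A \<longleftrightarrow> g z = e \<bullet> z"
proof
  assume z: "z \<in> frontier A"
  then have "z \<in> A" "z \<notin> interior A"
    using \<open>closed A\<close> by (auto simp: frontier_def)
  have "\<not> g z < e \<bullet> z"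
  proof
    assume "g z < e \<bullet> z"
    have "continuous_on UNIV g"
      using assms(5) by (rule lipschitz_on_continuous_on)
    then have "open {w. g w < e \<bullet> w}"
      by (intro open_Collect_less continuous_intros)
    then have "open (U \<inter> {w. g w < e \<bullet> w})"
      using \<open>open U\<close> by blast
    moreover have "U \<inter> {w. g w < e \<bullet> w} \<subseteq> A"
      using A by (blast intro: less_imp_le)
    ultimately show False
      using interiorI[of "U \<inter> {w. g w < e \<bullet> w}" z A] \<open>g z < e \<bullet> z\<close> \<open>z \<in> U\<close> \<open>z \<notin> interior A\<close>
      by blast
  qed
  moreover have "g z \<le> e \<bullet> z"
    using A \<open>z \<in> A\<close> \<open>z \<in> U\<close> by blast
  ultimately show "g z = e \<bullet> z"
    by simp
next
  assume gz: "g z = e \<bullet> z"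
  have ee: "e \<bullet> e = 1"
    using assms by (simp add: dot_square_norm)
  have "z \<in> A"
    using A gz \<open>z \<in> U\<close> by (blast intro: eq_refl)
  moreover have "z \<notin> interior A"
  proof
    assume "z \<in> interior A"
    have "((\<lambda>t. z + (- t) *\<^sub>R e) \<longlongrightarrow> z) (at_right (0::real))"
      by (rule tendsto_eq_intros refl | simp)+
    from topological_tendstoD[OF this, of "interior A \<inter> U"]
    have "\<forall>\<^sub>F t in at_right 0. z + (- t) *\<^sub>R e \<in> interior A \<inter> U"
      using \<open>z \<in> interior A\<close> \<open>z \<in> U\<close> \<open>open U\<close> by auto
    moreover have "\<forall>\<^sub>F t::real in at_right 0. t > 0"
      by (simp add: eventually_at_right_less)
    ultimately have "\<forall>\<^sub>F t::real in at_right 0. False"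
    proof eventually_elim
      case (elim t)
      then have "z + (- t) *\<^sub>R e \<in> A \<inter> U"
        using interior_subset by blast
      then have "g (z + (- t) *\<^sub>R e) \<le> e \<bullet> (z + (- t) *\<^sub>R e)"
        using A by blast
      then show False
        unfolding inv using gz elim by (simp add: inner_diff_right ee)
    qed
    then show False
      by simp
  qed
  ultimately show "z \<in> frontier A"
    using \<open>closed A\<close> by (simp add: frontier_def)
qed

section \<open>The boundary of the interior and the compactness argument\<close>

text \<open>This links the set that is assumed epi-Lipschitz to the boundary that occurs in the
  sphere condition.\<close>

lemma frontier_closure_interior:
  assumes "closed S"
  shows "frontier (closure (interior S)) = frontier (interior S)"
proof -
  have "closure (interior S) \<subseteq> S"
    using assms by (simp add: closure_minimal interior_subset)
  then have "interior (closure (interior S)) = interior S"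
    by (metis closure_subset interior_interior interior_mono subset_antisym)
  then show ?thesis
    by (simp add: frontier_def)
qed

lemma frontier_interior_subset: "frontier (interior S) \<subseteq> frontier S"
  using closure_mono[OF interior_subset[of S]] by (auto simp: frontier_def)

theorem theorem1p3:
  fixes S :: "(real ^ 'n::finite) set"
  assumes "closed S"
    and "epi_lipschitz (closure (interior S))"
    and "compact (frontier (closure (interior S)))"
  shows "(\<exists>r>0. prox_regular r S) \<longleftrightarrow> (\<exists>r'>0. extended_exterior_sphere_condition r' S)"
proof
  assume "\<exists>r>0. prox_regular r S"
  then obtain r where r: "r > 0" "prox_regular r S"
    by blast
  then have "extended_exterior_sphere_condition r S"
    unfolding extended_exterior_sphere_condition_def
    using prox_regular_imp_sphere_normal[OF \<open>closed S\<close> r(2,1)] frontier_interior_subset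
    unfolding prox_regular_def by (metis DiffD1 subsetD)
  then show "\<exists>r'>0. extended_exterior_sphere_condition r' S"
    using r(1) by blast
next
  assume "\<exists>r'>0. extended_exterior_sphere_condition r' S"
  then obtain r where r: "r > 0" "extended_exterior_sphere_condition r S"
    by blast
  define A where "A = closure (interior S)"
  define K where "K = frontier A"
  have K: "K = frontier (interior S)"
    unfolding K_def A_def using \<open>closed S\<close> by (rule frontier_closure_interior)
  have "closed A"
    by (simp add: A_def)
  have "A \<subseteq> S"
    using \<open>closed S\<close> by (simp add: A_def closure_minimal interior_subset)
  have sphere_normal: "\<exists>\<nu>. norm \<nu> = 1 \<and> (\<forall>s\<in>S. 2 * r * (\<nu> \<bullet> (s - z)) \<le> (norm (s - z))\<^sup>2)"
    if "z \<in> K" for z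
  proof -
    obtain \<zeta> where "\<zeta> \<noteq> 0" "realized_by_sphere r S z \<zeta>"
      using r(2) \<open>z \<in> K\<close> unfolding extended_exterior_sphere_condition_def K by blast
    then show ?thesis
      using realized_by_sphere_iff[of \<zeta> r S z] r(1) by (intro exI[of _ "sgn \<zeta>"]) (auto simp: norm_sgn)
  qed
  have "\<exists>U \<rho>. open U \<and> x \<in> U \<and> \<rho> > 0 \<and>
      (\<forall>z\<in>K \<inter> U. \<forall>\<zeta>\<in>proximal_normal_cone S z. \<zeta> \<noteq> 0 \<longrightarrow> realized_by_sphere \<rho> S z \<zeta>)"
    if "x \<in> K" for x
  proof -
    have "x \<in> A"
      using \<open>x \<in> K\<close> \<open>closed A\<close> by (simp add: K_def frontier_def)
    then have "epi_lipschitz_at A x"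
      using assms(2) by (simp add: epi_lipschitz_def A_def)
    then obtain U e L g where U: "open U" "x \<in> U" "norm e = 1" and lip: "L-lipschitz_on UNIV g"
      and inv: "\<And>z t. g (z + t *\<^sub>R e) = g z" and AU: "A \<inter> U = {z \<in> U. g z \<le> e \<bullet> z}"
      by (rule epi_lipschitz_at_directional) blast
    have KU: "z \<in> K \<longleftrightarrow> g z = e \<bullet> z" if "z \<in> U" for z
      unfolding K_def by (rule frontier_subgraph_iff[OF \<open>closed A\<close> U(1) that U(3) lip inv AU])
    define \<kappa> where "\<kappa> = (L + 2) ^ 3 / r"
    have "\<kappa> > 0"
      using r(1) lipschitz_on_nonneg[OF lip] by (simp add: \<kappa>_def)
    \<comment> \<open>A sphere of radius \<rho> corresponds to the quadratic constant 1/(2\<rho>),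
      here \<kappa>. Since \<kappa> depends only on \<open>L\<close> and \<open>r\<close>, this
      radius serves all of \<open>K \<inter> U\<close>.\<close>
    have "realized_by_sphere (1 / (2 * \<kappa>)) S z \<zeta>"
      if z: "z \<in> K \<inter> U" and \<zeta>: "\<zeta> \<in> proximal_normal_cone S z" "\<zeta> \<noteq> 0" for z \<zeta>
    proof -
      have "2 * (1 / (2 * \<kappa>)) * (sgn \<zeta> \<bullet> (s - z)) \<le> (norm (s - z))\<^sup>2" if "s \<in> S" for s
      proof -
        have "\<zeta> \<bullet> (s - z) \<le> \<kappa> * norm \<zeta> * (norm (s - z))\<^sup>2"
          unfolding \<kappa>_def
        proof (rule proximal_normal_inner_le[OF U(1) _ U(3) r(1) lip inv _ _ _ \<zeta>(1) \<open>s \<in> S\<close>])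
          show "z \<in> U" "g z = e \<bullet> z"
            using z KU by auto
          \<comment> \<open>Only the inclusion of the epigraph in \<open>S\<close> is asked for:
            \<open>S\<close> may have further points in \<open>U\<close> outside
            \<open>A\<close>.\<close>
          show "w \<in> S" if "w \<in> U" "g w \<le> e \<bullet> w" for w
            using that AU \<open>A \<subseteq> S\<close> by blast
          show "\<exists>\<nu>. norm \<nu> = 1 \<and> (\<forall>s\<in>S. 2 * r * (\<nu> \<bullet> (s - w)) \<le> (norm (s - w))\<^sup>2)"
            if "w \<in> U" "g w = e \<bullet> w" for w
            using that KU sphere_normal by blast
        qed
        then show ?thesis
          using \<open>\<kappa> > 0\<close> \<open>\<zeta> \<noteq> 0\<close> by (simp add: sgn_div_norm field_simps)
      qed
      then show ?thesis
        using realized_by_sphere_iff[OF \<open>\<zeta> \<noteq> 0\<close>, of "1 / (2 * \<kappa>)"] \<open>\<kappa> > 0\<close> by auto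
    qed
    then show ?thesis
      using U(1,2) \<open>\<kappa> > 0\<close> by (intro exI[of _ U] exI[of _ "1 / (2 * \<kappa>)"]) auto
  qed
  then obtain U \<rho> where U\<rho>: "\<And>x. x \<in> K \<Longrightarrow> open (U x)" "\<And>x. x \<in> K \<Longrightarrow> x \<in> U x"
    "\<And>x. x \<in> K \<Longrightarrow> \<rho> x > (0::real)"
    "\<And>x z \<zeta>. x \<in> K \<Longrightarrow> z \<in> K \<inter> U x \<Longrightarrow> \<zeta> \<in> proximal_normal_cone S z \<Longrightarrow> \<zeta> \<noteq> 0 \<Longrightarrow>
        realized_by_sphere (\<rho> x) S z \<zeta>"
    by metis
  have "compact K"
    using assms(3) by (simp add: K_def A_def)
  moreover have "K \<subseteq> (\<Union>x\<in>K. U x)"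
    using U\<rho>(2) by blast
  ultimately obtain F where F: "F \<subseteq> K" "finite F" "K \<subseteq> (\<Union>x\<in>F. U x)"
    using compactE_image[of K K U] U\<rho>(1) by metis
  \<comment> \<open>\<open>r\<close> is included for the boundary points outside \<open>K\<close>,
    where the second half of the sphere condition applies; it also covers the case of empty
    \<open>F\<close>.\<close>
  define R where "R = Min (insert r (\<rho> ` F))"
  have "R > 0"
    unfolding R_def using F U\<rho>(3) r(1) by (subst Min_gr_iff) auto
  have "R \<le> r" "\<And>x. x \<in> F \<Longrightarrow> R \<le> \<rho> x"
    unfolding R_def using F(2) by auto
  have "prox_regular R S"
    unfolding prox_regular_def
  proof (intro ballI impI)
    fix z \<zeta>
    assume z: "z \<in> frontier S" and \<zeta>: "\<zeta> \<in> proximal_normal_cone S z" "\<zeta> \<noteq> 0"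
    show "realized_by_sphere R S z \<zeta>"
    proof (cases "z \<in> K")
      case True
      then obtain x where x: "x \<in> F" "z \<in> U x"
        using F(3) by blast
      then have "realized_by_sphere (\<rho> x) S z \<zeta>"
        using U\<rho>(4) F(1) \<zeta> True by blast
      then show ?thesis
        using realized_by_sphere_mono \<zeta>(2) \<open>R > 0\<close> \<open>\<And>x. x \<in> F \<Longrightarrow> R \<le> \<rho> x\<close> x(1) by blast
    next
      case False
      then have "realized_by_sphere r S z \<zeta>"
        using r(2) z \<zeta> unfolding extended_exterior_sphere_condition_def K by blast
      then show ?thesis
        using realized_by_sphere_mono \<zeta>(2) \<open>R > 0\<close> \<open>R \<le> r\<close> by blast
    qed
  qed
  then show "\<exists>r>0. prox_regular r S"
    using \<open>R > 0\<close> by blast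
qed

end
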